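(* Let $\nu=\nu_1\nu_2\cdots\nu_{k-1}$ be a word of distinct integers in $[k]$, and let $r$ be the unique element of $[k]\setminus\{\nu_1,\ldots,\nu_{k-1}\}$. Let $\alpha=(\nu;\,r\to\nu_i)$, where $i\in[k-1]$ is such that $r>\nu_i$ and $r<\max(\nu_{i+1},\nu_{i+2},\ldots,\nu_{k-1})$ (in particular $i\le k-2$). Then $\alpha\sim\alpha^{r}$, where $\alpha^{r}$ denotes the reverse of the arrow pattern $\alpha$ (the superscript $r$ is not the integer $r$).
   Context: $[n]=\{1,\dots,n\}$, and $\mathcal{S}_n$ is the set of permutations $\pi=\pi_1\pi_2\cdots\pi_n$ of $[n]$ in one-line notation. The permutation $\hat\pi$: for $\pi\in\mathcal{S}_n$, $\hat\pi\in\mathcal{S}_n$ is the permutation whose cycle form is obtained from the word $\pi_1\cdots\pi_n$ by inserting a left parenthesis before each left-to-right maximum (an entry larger than all entries to its left) and a right parenthesis immediately before the next left-to-right maximum, or at the end of the word. A cycle $(c_1,c_2,\dots,c_s)$ means $c_1\mapsto c_2\mapsto\cdots\mapsto c_s\mapsto c_1$. Example: if $\pi=2537164$ then $\hat\pi=(2)(53)(7164)$. Arrow patterns: an arrow pattern of size $k$ is a pair $(\nu;H)$ where $\nu=\nu_1\cdots\nu_m$ is a word of distinct positive integers, $H$ is a collection of arrows $b_i\to c_i$, and the set of all integers appearing in $\nu$ or $H$ is $[k]$. A permutation $\pi\in\mathcal{S}_n$ contains $(\nu;H)$ if there are a set $X=\{x_1<x_2<\cdots<x_k\}\subseteq[n]$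 and indices $t_1<\cdots<t_m$ such that $\pi_{t_1}\pi_{t_2}\cdots\pi_{t_m}=x_{\nu_1}x_{\nu_2}\cdots x_{\nu_m}$ and $\hat\pi(x_{b_i})=x_{c_i}$ for every arrow $b_i\to c_i$ in $H$. Otherwise $\pi$ avoids $(\nu;H)$. $\mathcal{S}_n(\nu;H)$ is the set of permutations in $\mathcal{S}_n$ avoiding $(\nu;H)$. Two arrow patterns $\alpha,\beta$ are arrow-Wilf-equivalent, written $\alpha\sim\beta$, if $|\mathcal{S}_n(\alpha)|=|\mathcal{S}_n(\beta)|$ for all $n\ge 1$. For an arrow pattern $\alpha=(\nu;H)$ with $\nu=\nu_1\cdots\nu_m$ and $H=\{b_i\to c_i:1\le i\le t\}$, the reverse of $\alpha$ is the arrow pattern $\alpha^r=(\nu_m\nu_{m-1}\cdots\nu_1;\{c_i\to b_i:1\le i\le t\})$. *)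

theory Defs
  imports
    "HOL-Combinatorics.Cycles"
    "HOL-Combinatorics.Multiset_Permutations"
begin

text \<open>
  A permutation of \<open>{1..n}\<close> in one-line notation is an element of
  \<open>permutations_of_set {1..n}\<close>. Words are lists, so the letter \<open>\<pi>\<^sub>j\<close> is \<open>\<pi> ! (j - 1)\<close>.
\<close>

declare length_dropWhile_le [THEN le_imp_less_Suc, termination_simp]

text \<open>
  Cut a word before each left-to-right maximum. The first letter \<open>a\<close> of a block is a
  left-to-right maximum, hence the next one is the first later letter exceeding \<open>a\<close>.
\<close>
fun lr_max_blocks :: "nat list \<Rightarrow> nat list list" where
  "lr_max_blocks [] = []"
| "lr_max_blocks (a # w) =
     (a # takeWhile (\<lambda>b. b < a) w) # lr_max_blocks (dropWhile (\<lambda>b. b < a) w)"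

text \<open>
  The permutation whose cycle form has these blocks as cycles. The blocks of a word with
  distinct letters are disjoint, so the order of composition is irrelevant.
\<close>
definition hat :: "nat list \<Rightarrow> nat \<Rightarrow> nat" where
  "hat \<pi> = foldr (\<lambda>c f. cycle_of_list c \<circ> f) (lr_max_blocks \<pi>) id"

lemma lr_max_blocks_example:
  "lr_max_blocks [2, 5, 3, 7, 1, 6, 4] = [[2], [5, 3], [7, 1, 6, 4]]"
  by simp

lemma hat_example:
  "map (hat [2, 5, 3, 7, 1, 6, 4]) [1, 2, 3, 4, 5, 6, 7] = [6, 2, 5, 7, 3, 4, 1]"
  by (simp add: hat_def transpose_def)

text \<open>A pair \<open>(b, c)\<close> in the second component stands for the arrow \<open>b \<rightarrow> c\<close>.\<close>
type_synonym arrow_pattern = "nat list \<times> (nat \<times> nat) set"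

definition pattern_letters :: "arrow_pattern \<Rightarrow> nat set" where
  "pattern_letters \<alpha> = set (fst \<alpha>) \<union> Field (snd \<alpha>)"

definition is_arrow_pattern :: "nat \<Rightarrow> arrow_pattern \<Rightarrow> bool" where
  "is_arrow_pattern k \<alpha> \<longleftrightarrow> distinct (fst \<alpha>) \<and> pattern_letters \<alpha> = {1..k}"

definition pattern_size :: "arrow_pattern \<Rightarrow> nat" where
  "pattern_size \<alpha> = card (pattern_letters \<alpha>)"

lemma pattern_size_eq: "is_arrow_pattern k \<alpha> \<Longrightarrow> pattern_size \<alpha> = k"
  by (simp add: is_arrow_pattern_def pattern_size_def)

text \<open>
  The set \<open>X\<close> is given by its increasing enumeration \<open>x\<close> on \<open>{1..k}\<close>. The positions \<open>t\<close> are
  counted from 0, following list indexing.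
\<close>
definition contains_arrow :: "nat list \<Rightarrow> arrow_pattern \<Rightarrow> bool" where
  "contains_arrow \<pi> \<alpha> \<longleftrightarrow>
     (\<exists>(x :: nat \<Rightarrow> nat) (t :: nat \<Rightarrow> nat).
        strict_mono_on {1..pattern_size \<alpha>} x \<and>
        x ` {1..pattern_size \<alpha>} \<subseteq> {1..length \<pi>} \<and>
        strict_mono_on {..<length (fst \<alpha>)} t \<and>
        t ` {..<length (fst \<alpha>)} \<subseteq> {..<length \<pi>} \<and>
        (\<forall>j < length (fst \<alpha>). \<pi> ! t j = x (fst \<alpha> ! j)) \<and>
        (\<forall>(b, c) \<in> snd \<alpha>. hat \<pi> (x b) = x c))"

definition arrow_avoiders :: "nat \<Rightarrow> arrow_pattern \<Rightarrow> nat list set" where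
  "arrow_avoiders n \<alpha> = {\<pi> \<in> permutations_of_set {1..n}. \<not> contains_arrow \<pi> \<alpha>}"

definition arrow_wilf_equiv :: "arrow_pattern \<Rightarrow> arrow_pattern \<Rightarrow> bool" (infix "\<sim>\<^sub>w" 50) where
  "\<alpha> \<sim>\<^sub>w \<beta> \<longleftrightarrow> (\<forall>n\<ge>1. card (arrow_avoiders n \<alpha>) = card (arrow_avoiders n \<beta>))"

definition arrow_reverse :: "arrow_pattern \<Rightarrow> arrow_pattern" where
  "arrow_reverse \<alpha> = (rev (fst \<alpha>), (snd \<alpha>)\<inverse>)"

lemma is_arrow_pattern_reverse:
  "is_arrow_pattern k (arrow_reverse \<alpha>) \<longleftrightarrow> is_arrow_pattern k \<alpha>"
  by (simp add: is_arrow_pattern_def pattern_letters_def arrow_reverse_def)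

lemma is_arrow_pattern_single_arrow:
  assumes "distinct \<nu>" and "set \<nu> \<subseteq> {1..k}" and "{1..k} - set \<nu> = {r}" and "c \<in> set \<nu>"
  shows "is_arrow_pattern k (\<nu>, {(r, c)})"
  using assms by (auto simp: is_arrow_pattern_def pattern_letters_def Field_def)

end

theory Submission
  imports Defs
begin

text \<open>
  If some letter at or before the position of \<open>b\<close> exceeds \<open>c\<close>, then \<open>c\<close> can be the image of \<open>b\<close>
  under \<open>hat \<pi>\<close> only by being the letter right after \<open>b\<close>: the last letter of a block is mapped
  to the leader of the block, which dominates everything before it. For an occurrence of
  \<open>\<alpha>\<close> such a letter is \<open>b\<close> itself, since \<open>r > \<nu>\<^sub>i\<close>; for an occurrence of the reverse of \<open>\<alpha>\<close> it is
  the letter playing the role of the maximum of \<open>\<nu>\<^sub>i\<^sub>+\<^sub>1, \<dots>, \<nu>\<^sub>k\<^sub>-\<^sub>1\<close>, which now stands on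
  the left. So both arrows are adjacency conditions, and \<open>\<pi>\<close> contains \<open>\<alpha>\<close> iff the reversed word
  contains the reverse of \<open>\<alpha>\<close>.
\<close>

lemma cycle_of_list_nth:
  assumes "distinct cs" and "p < length cs"
  shows "cycle_of_list cs (cs ! p) = cs ! (Suc p mod length cs)"
proof -
  have "map (cycle_of_list cs) cs = rotate1 cs"
    using cyclic_rotation[OF assms(1), of 1] by simp
  then have "map (cycle_of_list cs) cs ! p = rotate1 cs ! p"
    by simp
  with assms(2) show ?thesis
    by (simp add: nth_rotate1)
qed

lemma hat_Cons:
  "hat (a # w) = cycle_of_list (a # takeWhile (\<lambda>b. b < a) w) \<circ> hat (dropWhile (\<lambda>b. b < a) w)"
  by (simp add: hat_def)

text \<open>Separates the blocks: \<open>hat\<close> of the remaining word fixes the letters of the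
  first block and sends its own letters to its own letters, so at most one factor in
  \<open>hat_Cons\<close> moves a given letter or its image.\<close>

lemma hat_permutes: "hat w permutes set w"
proof (induction w rule: lr_max_blocks.induct)
  case 1
  show ?case by (simp add: hat_def permutes_def)
next
  case (2 a w)
  let ?u = "takeWhile (\<lambda>b. b < a) w" and ?v = "dropWhile (\<lambda>b. b < a) w"
  have sub: "set (a # ?u) \<subseteq> set (a # w)" "set ?v \<subseteq> set (a # w)"
    by (auto dest: set_takeWhileD set_dropWhileD)
  have "cycle_of_list (a # ?u) permutes set (a # w)"
    using cycle_permutes sub(1) by (rule permutes_subset)
  moreover have "hat ?v permutes set (a # w)"
    using 2 sub(2) by (rule permutes_subset)
  ultimately show ?case
    unfolding hat_Cons by (intro permutes_compose)
qed

text \<open>Induction on blocks. Inside a block the image is the next letter. At a block end neither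
  side holds: the image is the leader, and a following letter leads the next block; both are at
  least \<open>w ! q\<close>. The index \<open>q\<close> is kept apart from \<open>p\<close> because
  in the reversed word the large letter is another one.\<close>

lemma hat_nth_eq_iff:
  assumes "distinct w" and "p < length w" and "q \<le> p" and "c < w ! q"
  shows "hat w (w ! p) = c \<longleftrightarrow> Suc p < length w \<and> w ! Suc p = c"
  using assms
proof (induction w arbitrary: p q rule: lr_max_blocks.induct)
  case 1
  then show ?case by simp
next
  case (2 a w)
  define u where "u = takeWhile (\<lambda>b. b < a) w"
  define v where "v = dropWhile (\<lambda>b. b < a) w"
  have w: "a # w = (a # u) @ v"
    by (simp add: u_def v_def)
  have len: "length w = length u + length v"
    unfolding u_def v_def length_append[symmetric] by simp
  have nth_u: "(a # w) ! j = (a # u) ! j" if "j < length (a # u)" for j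
    unfolding w nth_append using that by simp
  have nth_v: "(a # w) ! (length (a # u) + j) = v ! j" for j
    unfolding w by (rule nth_append_length_plus)
  have hat: "hat (a # w) = cycle_of_list (a # u) \<circ> hat v"
    by (simp add: hat_Cons u_def v_def)
  have dist: "distinct (a # u)" "distinct v" "set (a # u) \<inter> set v = {}"
    using \<open>distinct (a # w)\<close> unfolding w distinct_append by blast+
  have lead: "(a # u) ! j \<le> a" if "j < length (a # u)" for j
    using nth_mem[OF that] by (auto simp: u_def dest: set_takeWhileD)
  have hd_v: "a \<le> v ! 0" if "v \<noteq> []"
    using that hd_dropWhile[of "\<lambda>b. b < a" w] by (simp add: v_def hd_conv_nth)
  show ?case
  proof (cases "p < length (a # u)")
    case True
    have nth: "(a # w) ! p = (a # u) ! p" "(a # w) ! q = (a # u) ! q"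
      using True \<open>q \<le> p\<close> nth_u by simp_all
    have "(a # u) ! p \<notin> set v"
      using True dist(3) nth_mem by blast
    then have val: "hat (a # w) ((a # w) ! p) = (a # u) ! (Suc p mod length (a # u))"
      using permutes_not_in[OF hat_permutes] cycle_of_list_nth[OF dist(1) True]
      by (simp add: hat nth)
    show ?thesis
    proof (cases "Suc p < length (a # u)")
      case True
      then show ?thesis
        unfolding val using nth_u[OF True] by (simp add: len)
    next
      case False
      then have last: "Suc p = length (a # u)"
        using True by simp
      \<comment> \<open>The index wraps around to 0, so the image is \<open>a\<close>, which differs
        from \<open>c\<close>.\<close>
      have "c < a"
        using \<open>c < (a # w) ! q\<close> lead[of q] nth True \<open>q \<le> p\<close> by simp
      moreover have "a \<le> (a # w) ! Suc p" if "Suc p < length (a # w)"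
        using that hd_v nth_v[of 0] last len by auto
      ultimately show ?thesis
        using val last by auto
    qed
  next
    case False
    define p' where "p' = p - length (a # u)"
    have p: "p = length (a # u) + p'"
      using False by (simp add: p'_def)
    have p'_lt: "p' < length v"
      using \<open>p < length (a # w)\<close> unfolding w p by simp
    have "hat v (v ! p') \<in> set v"
      using p'_lt permutes_in_image[OF hat_permutes] by simp
    then have val: "hat (a # w) ((a # w) ! p) = hat v (v ! p')"
      using dist(3) id_outside_supp[of "hat v (v ! p')" "a # u"] unfolding hat p nth_v o_apply
      by blast
    \<comment> \<open>The induction hypothesis needs a large letter inside \<open>v\<close>. If
      \<open>q\<close> falls in the first block, then \<open>c\<close> is below its leader
      \<open>a\<close>, hence below the first letter of \<open>v\<close>, and index 0 serves;
      otherwise \<open>q\<close> is shifted.\<close>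
    obtain q' where q': "q' \<le> p'" "c < v ! q'"
    proof (cases "q < length (a # u)")
      case True
      then have "c < a"
        using \<open>c < (a # w) ! q\<close> nth_u lead[of q] by simp
      then have "c < v ! 0"
        using hd_v p'_lt by fastforce
      then show ?thesis
        using that[of 0] by simp
    next
      case False
      show ?thesis
      proof (rule that)
        show "q - length (a # u) \<le> p'"
          using \<open>q \<le> p\<close> p by linarith
        show "c < v ! (q - length (a # u))"
          using \<open>c < (a # w) ! q\<close> nth_v[of "q - length (a # u)"] False by simp
      qed
    qed
    have "hat v (v ! p') = c \<longleftrightarrow> Suc p' < length v \<and> v ! Suc p' = c"
      using 2(1)[folded v_def] dist(2) p'_lt q' by blast
    then show ?thesis
      unfolding val using nth_v[of "Suc p'"] by (simp add: len p)
  qed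
qed

text \<open>Mirroring the positions in the word and the indices in the pattern flips the order
  twice, so the new positions increase again; the values \<open>x\<close> stay.\<close>

lemma nth_rev_embedding:
  fixes t :: "nat \<Rightarrow> nat"
  assumes mono: "strict_mono_on {..<length \<nu>} t"
    and range: "t ` {..<length \<nu>} \<subseteq> {..<length \<pi>}"
    and occ: "\<forall>j<length \<nu>. \<pi> ! t j = x (\<nu> ! j)"
  shows "\<exists>t'. strict_mono_on {..<length (rev \<nu>)} t' \<and>
    t' ` {..<length (rev \<nu>)} \<subseteq> {..<length (rev \<pi>)} \<and>
    (\<forall>j<length (rev \<nu>). rev \<pi> ! t' j = x (rev \<nu> ! j))"
proof (intro exI conjI)
  let ?t = "\<lambda>j. length \<pi> - Suc (t (length \<nu> - Suc j))"
  have lt: "t j < length \<pi>" if "j < length \<nu>" for j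
    using that range by auto
  show "strict_mono_on {..<length (rev \<nu>)} ?t"
  proof (rule strict_mono_onI)
    fix i j assume "i \<in> {..<length (rev \<nu>)}" "j \<in> {..<length (rev \<nu>)}" "i < j"
    then have "t (length \<nu> - Suc j) < t (length \<nu> - Suc i)"
      by (intro strict_mono_onD[OF mono]) auto
    moreover have "t (length \<nu> - Suc i) < length \<pi>"
      using \<open>i \<in> _\<close> by (intro lt) auto
    ultimately show "?t i < ?t j"
      by linarith
  qed
  show "?t ` {..<length (rev \<nu>)} \<subseteq> {..<length (rev \<pi>)}"
    using lt by fastforce
  show "\<forall>j<length (rev \<nu>). rev \<pi> ! ?t j = x (rev \<nu> ! j)"
  proof (intro allI impI)
    fix j assume "j < length (rev \<nu>)"
    then have j: "length \<nu> - Suc j < length \<nu>" "j < length \<nu>"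
      by auto
    show "rev \<pi> ! ?t j = x (rev \<nu> ! j)"
      using lt[OF j(1)] occ j by (simp add: rev_nth Suc_diff_Suc)
  qed
qed

text \<open>Both sides say that \<open>b\<close> stands immediately before \<open>\<pi> ! p\<close>
  in \<open>\<pi>\<close>.\<close>

lemma hat_rev_iff:
  assumes "distinct \<pi>" and "b \<in> set \<pi>"
    and "p < q" and "q < length \<pi>" and "\<pi> ! p < b" and "b < \<pi> ! q"
  shows "hat (rev \<pi>) (\<pi> ! p) = b \<longleftrightarrow> hat \<pi> b = \<pi> ! p"
proof -
  let ?n = "length \<pi>"
  obtain s where s: "s < ?n" "b = \<pi> ! s"
    using \<open>b \<in> set \<pi>\<close> by (auto simp: in_set_conv_nth)
  have p: "p < ?n"
    using \<open>p < q\<close> \<open>q < ?n\<close> by simp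
  have rev_nth': "rev \<pi> ! (?n - Suc j) = \<pi> ! j" if "j < ?n" for j
    using that by (simp add: rev_nth Suc_diff_Suc)
  have "hat \<pi> b = \<pi> ! p \<longleftrightarrow> Suc s < ?n \<and> \<pi> ! Suc s = \<pi> ! p"
    using hat_nth_eq_iff[OF \<open>distinct \<pi>\<close> s(1), of s] \<open>\<pi> ! p < b\<close> s by simp
  also have "\<dots> \<longleftrightarrow> Suc s = p"
    using p \<open>distinct \<pi>\<close> by (auto simp: nth_eq_iff_index_eq)
  finally have fwd: "hat \<pi> b = \<pi> ! p \<longleftrightarrow> Suc s = p" .
  \<comment> \<open>Now the target is \<open>b\<close>, and the letter exceeding it is
    \<open>\<pi> ! q\<close>, whose mirror position precedes that of \<open>\<pi> ! p\<close>
    because \<open>p < q\<close>.\<close>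
  have "hat (rev \<pi>) (rev \<pi> ! (?n - Suc p)) = b \<longleftrightarrow>
      Suc (?n - Suc p) < length (rev \<pi>) \<and> rev \<pi> ! Suc (?n - Suc p) = b"
    using assms p rev_nth'[of q] by (intro hat_nth_eq_iff[where q = "?n - Suc q"]) auto
  \<comment> \<open>The length bound turns into \<open>0 < p\<close>, which keeps the subtraction
    \<open>p - 1\<close> from being truncated.\<close>
  also have "\<dots> \<longleftrightarrow> 0 < p \<and> \<pi> ! (p - 1) = b"
    using p rev_nth'[of "p - 1"] by (cases p) (auto simp: Suc_diff_Suc)
  also have "\<dots> \<longleftrightarrow> Suc s = p"
    using p s \<open>distinct \<pi>\<close> by (cases p) (auto simp: nth_eq_iff_index_eq)
  finally show ?thesis
    using fwd rev_nth'[OF p] by simp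
qed

text \<open>The same \<open>x\<close> serves both sides: positions are mirrored, and
  \<open>hat_rev_iff\<close> at \<open>t i < t j\<close> matches the arrows.\<close>

lemma contains_arrow_rev_iff:
  assumes pat: "is_arrow_pattern k (\<nu>, {(r, \<nu> ! i)})"
    and i: "i < j" "j < length \<nu>"
    and r: "\<nu> ! i < r" "r < \<nu> ! j"
    and \<pi>: "\<pi> \<in> permutations_of_set {1..n}"
  shows "contains_arrow (rev \<pi>) (arrow_reverse (\<nu>, {(r, \<nu> ! i)})) \<longleftrightarrow>
    contains_arrow \<pi> (\<nu>, {(r, \<nu> ! i)})"
proof -
  let ?\<alpha> = "(\<nu>, {(r, \<nu> ! i)})"
  have size: "pattern_size ?\<alpha> = k" "pattern_size (arrow_reverse ?\<alpha>) = k"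
    using pat by (simp_all add: pattern_size_eq is_arrow_pattern_reverse)
  \<comment> \<open>Containment is split into values, positions and arrow; only the last two are
    affected by reversal.\<close>
  define inc where "inc x \<longleftrightarrow> strict_mono_on {1..k} x \<and> x ` {1..k} \<subseteq> {1..length \<pi>}"
    for x :: "nat \<Rightarrow> nat"
  define occ where "occ x \<mu> \<rho> t \<longleftrightarrow> strict_mono_on {..<length \<mu>} t \<and>
      t ` {..<length \<mu>} \<subseteq> {..<length \<rho>} \<and> (\<forall>j<length \<mu>. \<rho> ! t j = x (\<mu> ! j))"
    for x :: "nat \<Rightarrow> nat" and \<mu> \<rho> :: "nat list" and t :: "nat \<Rightarrow> nat"
  have occ_revI: "\<exists>t. occ x (rev \<mu>) (rev \<rho>) t" if "occ x \<mu> \<rho> t" for x \<mu> \<rho> t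
    using that nth_rev_embedding[of \<mu> t \<rho> x] unfolding occ_def by blast
  have occ_rev: "(\<exists>t. occ x (rev \<nu>) (rev \<pi>) t) \<longleftrightarrow> (\<exists>t. occ x \<nu> \<pi> t)" for x
    using occ_revI[of x \<nu> \<pi>] occ_revI[of x "rev \<nu>" "rev \<pi>"] by auto
  have dist: "distinct \<pi>" and set_\<pi>: "set \<pi> = {1..length \<pi>}"
    using \<pi> permutations_of_setD[OF \<pi>] length_finite_permutations_of_set[OF \<pi>] by simp_all
  have letters: "set \<nu> \<subseteq> {1..k}" "r \<in> {1..k}"
    using pat by (auto simp: is_arrow_pattern_def pattern_letters_def Field_def)
  have hat_iff: "hat (rev \<pi>) (x (\<nu> ! i)) = x r \<longleftrightarrow> hat \<pi> (x r) = x (\<nu> ! i)"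
    if x: "inc x" and t: "occ x \<nu> \<pi> t" for x t
  proof -
    have mono: "x a < x b" if "a < b" "a \<in> {1..k}" "b \<in> {1..k}" for a b
      using x that by (auto simp: inc_def intro: strict_mono_onD)
    have mem: "\<nu> ! i \<in> {1..k}" "\<nu> ! j \<in> {1..k}"
      using i by (intro subsetD[OF letters(1)] nth_mem, linarith)+
    have nth: "\<pi> ! t i = x (\<nu> ! i)" "\<pi> ! t j = x (\<nu> ! j)"
      using t i by (auto simp: occ_def)
    have "hat (rev \<pi>) (\<pi> ! t i) = x r \<longleftrightarrow> hat \<pi> (x r) = \<pi> ! t i"
    proof (rule hat_rev_iff[OF dist])
      \<comment> \<open>This rests on \<open>\<pi>\<close> containing every value up to its length,
        not on a position prescribed by \<open>\<nu>\<close>.\<close>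
      show "x r \<in> set \<pi>"
        using x letters(2) unfolding set_\<pi> inc_def by blast
      show "t i < t j"
        using t i unfolding occ_def by (auto intro: strict_mono_onD)
      show "t j < length \<pi>"
        using t i by (auto simp: occ_def)
      show "\<pi> ! t i < x r"
        unfolding nth using r(1) mem(1) letters(2) by (rule mono)
      show "x r < \<pi> ! t j"
        unfolding nth using r(2) letters(2) mem(2) by (rule mono)
    qed
    then show ?thesis
      by (simp add: nth)
  qed
  have contains: "contains_arrow \<rho> (\<mu>, {(b, c)}) \<longleftrightarrow>
      (\<exists>x. inc x \<and> (\<exists>t. occ x \<mu> \<rho> t) \<and> hat \<rho> (x b) = x c)"
    if "pattern_size (\<mu>, {(b, c)}) = k" "length \<rho> = length \<pi>" for \<mu> \<rho> b c
    using that by (simp add: contains_arrow_def inc_def occ_def) blast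
  have \<alpha>r: "arrow_reverse ?\<alpha> = (rev \<nu>, {(\<nu> ! i, r)})"
    by (auto simp: arrow_reverse_def)
  show ?thesis
    using contains[OF size(1) refl] contains[OF size(2)[unfolded \<alpha>r], of "rev \<pi>"] hat_iff
    unfolding \<alpha>r occ_rev by (simp only: length_rev) blast
qed

theorem proposition2p6:
  fixes k r i :: nat and \<nu> :: "nat list"
  assumes "length \<nu> = k - 1"
    and "distinct \<nu>"
    and "set \<nu> \<subseteq> {1..k}"
    and "{1..k} - set \<nu> = {r}"
    and "i \<in> {1..k - 1}"
    and "i \<le> k - 2"
    and "r > \<nu> ! (i - 1)"
    and "r < Max (set (drop i \<nu>))"
  shows "(\<nu>, {(r, \<nu> ! (i - 1))}) \<sim>\<^sub>w arrow_reverse (\<nu>, {(r, \<nu> ! (i - 1))})"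
proof -
  let ?\<alpha> = "(\<nu>, {(r, \<nu> ! (i - 1))})"
  have i: "1 \<le> i" "i < length \<nu>"
    using assms(1,5,6) by auto
  have pat: "is_arrow_pattern k ?\<alpha>"
    using assms(2-4) i by (intro is_arrow_pattern_single_arrow) auto
  \<comment> \<open>With \<open>i\<close> counted from 1, \<open>drop i \<nu>\<close> starts just
    after the arrow's target at index \<open>i - 1\<close>, so index \<open>j\<close> of its maximum
    is index \<open>i + j\<close> of \<open>\<nu>\<close>.\<close>
  have "Max (set (drop i \<nu>)) \<in> set (drop i \<nu>)"
    using i by (intro Max_in) auto
  then obtain j where "j < length (drop i \<nu>)" "drop i \<nu> ! j = Max (set (drop i \<nu>))"
    by (auto simp: in_set_conv_nth)
  then have j: "i - 1 < i + j" "i + j < length \<nu>" "r < \<nu> ! (i + j)"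
    using i assms(8) by auto
  note rev_iff = contains_arrow_rev_iff[OF pat j(1,2) assms(7) j(3)]
  have rev_mem: "rev \<pi> \<in> permutations_of_set A \<longleftrightarrow> \<pi> \<in> permutations_of_set A"
    for \<pi> :: "nat list" and A
    by (simp add: permutations_of_set_def)
  \<comment> \<open>Reversal is its own inverse; the second inclusion is \<open>rev_iff\<close>
    applied to the reversed word.\<close>
  have "bij_betw rev (arrow_avoiders n ?\<alpha>) (arrow_avoiders n (arrow_reverse ?\<alpha>))" for n
  proof (rule bij_betw_byWitness[where f' = rev])
    show "rev ` arrow_avoiders n ?\<alpha> \<subseteq> arrow_avoiders n (arrow_reverse ?\<alpha>)"
      using rev_iff by (auto simp: arrow_avoiders_def rev_mem)
    show "rev ` arrow_avoiders n (arrow_reverse ?\<alpha>) \<subseteq> arrow_avoiders n ?\<alpha>"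
    proof (rule image_subsetI)
      fix \<pi> assume "\<pi> \<in> arrow_avoiders n (arrow_reverse ?\<alpha>)"
      then show "rev \<pi> \<in> arrow_avoiders n ?\<alpha>"
        using rev_iff[of "rev \<pi>" n] by (simp add: arrow_avoiders_def rev_mem)
    qed
  qed simp_all
  then show ?thesis
    unfolding arrow_wilf_equiv_def using bij_betw_same_card by blast
qed

end
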